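(* Let $p\in(1,2]$, $q>0$, $\eta>0$, $B>0$, $r\in(0,1)$. There is a constant $c>0$ depending only on $p,q,\eta,B,r$ such that for all $\Delta_1>0$, $L>0$, $\sigma\ge0$ and all sufficiently small $\varepsilon>0$ (the threshold may depend on all the parameters above) the following holds. For every horizon $T\ge1$ for which the total number of samples $T\cdot\lceil\max\{1,BT^q\}\rceil$ is smaller than $$c\left(\Big(\frac{\Delta_1}{\varepsilon}\Big)^{\frac{1+q}{1-r}}+\Big(\frac{L}{\varepsilon}\Big)^{\frac{1+q}{r}}+\Big(\frac{\sigma}{\varepsilon}\Big)^{\frac{p(q+1)}{q(p-1)}}\right),$$ there exist an $L$-smooth, lower bounded function $F$ with $F(x_1)-\inf F\le\Delta_1$ and a gradient oracle $\nabla f(\cdot,\cdot)$ for $F$ satisfying the $p$-BCM assumption with constant $\sigma$, such that the iterates of minibatch-NSGD with parameters $\eta_t\equiv\eta T^{-r}$ and $B_t\equiv\lceil\max\{1,BT^q\}\rceil$ satisfy $\mathbb{E}[\|\nabla F(x_t)\|]>\varepsilon$ for all $t\in\{1,\dots,T\}$. In other words, minibatch-NSGD with these parameters requires at least $$\Omega\left(\Big(\frac{\Delta_1}{\varepsilon}\Big)^{\frac{1+q}{1-r}}+\Big(\frac{L}{\varepsilon}\Big)^{\frac{1+q}{r}}+\Big(\frac{\sigma}{\varepsilon}\Big)^{\frac{p(q+1)}{q(p-1)}}\right)$$ samples to generate an iterate with $\mathbb{E}[\|\nabla F(x_t)\|]\le\varepsilon$.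
   Context: $F$ is $L$-smooth if it is differentiable and $\|\nabla F(x)-\nabla F(y)\|\le L\|x-y\|$ for all $x,y$. A gradient oracle $\nabla f(\cdot,\xi)$ (with $\xi$ a random variable) satisfies the $p$-BCM assumption with constant $\sigma$ if for all $x$: $\mathbb{E}[\nabla f(x,\xi)]=\nabla F(x)$ and $\mathbb{E}[\|\nabla f(x,\xi)-\nabla F(x)\|^p]\le\sigma^p$. minibatch-NSGD: from a deterministic initial point $x_1$, iterate $x_{t+1}=x_t-\eta_t\,g_t/\|g_t\|$ with $g_t=\frac1{B_t}\sum_{j=1}^{B_t}\nabla f(x_t,\xi_t^{(j)})$, where all $\xi_t^{(j)}$ are independent copies of $\xi$. Convention: $g/\|g\|:=0$ if $g=0$. The domain of $F$ may be taken to be $\mathbb{R}$ (dimension $d$ is not prescribed). *)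

theory Defs
  imports "HOL-Probability.Probability"
begin

definition gradient :: "('a::euclidean_space \<Rightarrow> real) \<Rightarrow> 'a \<Rightarrow> 'a" where
  "gradient F x = (THE g. GDERIV F x :> g)"

definition smooth_fun :: "real \<Rightarrow> ('a::euclidean_space \<Rightarrow> real) \<Rightarrow> bool" where
  "smooth_fun L F \<longleftrightarrow> (\<forall>x. F differentiable (at x)) \<and>
     (\<forall>x y. norm (gradient F x - gradient F y) \<le> L * norm (x - y))"

text \<open>\<open>D\<close> is the law of the random variable \<open>\<xi>\<close> and \<open>G x \<xi>\<close> is the oracle's answer at \<open>x\<close>.
  Joint measurability makes the iterates random variables; the integrability
  clauses are needed because the Bochner integral of a non-integrable function is 0.\<close>

definition bcm_oracle ::
    "real \<Rightarrow> real \<Rightarrow> 's measure \<Rightarrow> ('a::euclidean_space \<Rightarrow> real) \<Rightarrow> ('a \<Rightarrow> 's \<Rightarrow> 'a) \<Rightarrow> bool" where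
  "bcm_oracle p \<sigma> D F G \<longleftrightarrow>
     prob_space D \<and>
     (\<lambda>(x, \<xi>). G x \<xi>) \<in> borel_measurable (borel \<Otimes>\<^sub>M D) \<and>
     (\<forall>x. integrable D (G x) \<and> (\<integral>\<xi>. G x \<xi> \<partial>D) = gradient F x) \<and>
     (\<forall>x. integrable D (\<lambda>\<xi>. norm (G x \<xi> - gradient F x) powr p) \<and>
          (\<integral>\<xi>. norm (G x \<xi> - gradient F x) powr p \<partial>D) \<le> \<sigma> powr p)"

text \<open>Iterates are indexed from 1; index 0 is a dummy. The argument \<open>\<omega> (t, j)\<close> is the \<open>j\<close>-th
  sample drawn in step \<open>t\<close>. The library's \<open>sgn g\<close> is \<open>g / \<parallel>g\<parallel>\<close>, with \<open>sgn 0 = 0\<close>.\<close>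

primrec minibatch_nsgd ::
    "('a::euclidean_space \<Rightarrow> 's \<Rightarrow> 'a) \<Rightarrow> (nat \<Rightarrow> real) \<Rightarrow> (nat \<Rightarrow> nat) \<Rightarrow> 'a
      \<Rightarrow> (nat \<times> nat \<Rightarrow> 's) \<Rightarrow> nat \<Rightarrow> 'a" where
  "minibatch_nsgd G \<eta> B x1 \<omega> 0 = x1"
| "minibatch_nsgd G \<eta> B x1 \<omega> (Suc t) =
     (if t = 0 then x1
      else let x = minibatch_nsgd G \<eta> B x1 \<omega> t;
               g = (1 / real (B t)) *\<^sub>R (\<Sum>j=1..B t. G x (\<omega> (t, j)))
           in x - \<eta> t *\<^sub>R sgn g)"

text \<open>The joint law of independent copies \<open>\<xi>\<^sub>t\<^sup>j\<close> of a random variable with law \<open>D\<close>.\<close>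

definition iid_samples :: "'s measure \<Rightarrow> (nat \<times> nat \<Rightarrow> 's) measure" where
  "iid_samples D = (\<Pi>\<^sub>M i\<in>UNIV. D)"

definition batch_size :: "real \<Rightarrow> real \<Rightarrow> nat \<Rightarrow> nat" where
  "batch_size B q T = nat \<lceil>max 1 (B * real T powr q)\<rceil>"

end

theory Submission
  imports Defs
begin

text \<open>If \<open>T B\<^sub>T\<close> is small, then one of three things happens.
  (a) The total path length \<open>\<eta> T\<^bsup>1-r\<^esup>\<close> is too short to descend by \<open>\<Delta>\<^sub>1/2\<close> along a slope of \<open>2\<epsilon>\<close>.
  (b) The step size \<open>h = \<eta> T\<^bsup>-r\<^esup>\<close> is at least \<open>4\<epsilon>/L\<close>, so exact gradient steps on a Huber function jump
  back and forth between two points of slope \<open>\<plusminus>2\<epsilon>\<close>.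
  (c) The batch size is of order at most \<open>(\<sigma>/\<epsilon>)\<^bsup>p/(p-1)\<^esup>\<close>. Multiply the true gradient by a noise factor
  of mean 1 that equals \<open>-1\<close> except with probability \<open>1/(32 B\<^sub>T)\<close>. Then a batch points uphill with
  probability at least \<open>31/32\<close>. On a function with slope \<open>2\<epsilon>\<close> to the right of \<open>x\<^sub>1\<close>, the iterates
  dominate \<open>x\<^sub>1 + h S\<close> for a random walk \<open>S\<close> with upward drift, up to the first time that \<open>S\<close>
  becomes negative. An exponential moment bound and a union bound show that this ever happens with
  probability at most \<open>1/4\<close>, uniformly in \<open>T\<close>.\<close>

section \<open>Smooth one-dimensional building blocks\<close>

lemma gradient_eqI: "DERIV F x :> g \<Longrightarrow> gradient F x = (g::real)"
  unfolding gradient_def by (rule the_equality) (auto intro: DERIV_unique)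

lemma smooth_funI:
  fixes F F' :: "real \<Rightarrow> real"
  assumes "\<And>x. DERIV F x :> F' x" and "\<And>x y. \<bar>F' x - F' y\<bar> \<le> L * \<bar>x - y\<bar>"
  shows "smooth_fun L F"
proof -
  have "gradient F = F'"
    using assms(1) by (intro ext gradient_eqI)
  moreover have "F differentiable (at x)" for x
    using assms(1) real_differentiable_def by blast
  ultimately show ?thesis
    using assms(2) by (auto simp: smooth_fun_def)
qed

lemma DERIV_max_square: "DERIV (\<lambda>x. (max 0 x)\<^sup>2 / 2) x :> max 0 (x::real)"
proof -
  consider "x < 0" | "x = 0" | "0 < x" by linarith
  then show ?thesis
  proof cases
    case 1
    have "DERIV (\<lambda>_. 0) x :> (0::real)" by simp
    then have "DERIV (\<lambda>x. (max 0 x)\<^sup>2 / 2) x :> 0"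
      by (rule has_field_derivative_transform_within_open[where S = "{..<0}"]) (use 1 in auto)
    then show ?thesis using 1 by simp
  next
    case 2
    \<comment> \<open>At the kink, Caratheodory's criterion applies: \<open>max 0 z / 2\<close> is
      the difference quotient of the function at 0, and it extends continuously by the value
      0.\<close>
    have "isCont (\<lambda>z::real. max 0 z / 2) 0" by (intro continuous_intros) auto
    moreover have "(max 0 z)\<^sup>2 / 2 = max 0 z / 2 * (z::real)" for z
      by (auto simp: max_def power2_eq_square)
    ultimately show ?thesis
      using 2 by (auto simp: CARAT_DERIV intro!: exI[of _ "\<lambda>z. max 0 z / 2"])
  next
    case 3
    have "DERIV (\<lambda>x. x\<^sup>2 / 2) x :> x" by (auto intro!: derivative_eq_intros)
    then have "DERIV (\<lambda>x. (max 0 x)\<^sup>2 / 2) x :> x"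
      by (rule has_field_derivative_transform_within_open[where S = "{0<..}"]) (use 3 in auto)
    then show ?thesis using 3 by simp
  qed
qed

text \<open>For \<open>w\<close> \<ge> 0 this is a one-sided Huber function: 0 up to 0, the parabola
  with curvature \<open>L\<close> on [0, \<open>w\<close>], then a line of slope
  \<open>L * w\<close>. The second square cancels the curvature beyond \<open>w\<close>.\<close>

definition ramp :: "real \<Rightarrow> real \<Rightarrow> real \<Rightarrow> real" where
  "ramp L w x = L * ((max 0 x)\<^sup>2 / 2 - (max 0 (x - w))\<^sup>2 / 2)"

lemma DERIV_ramp:
  assumes "0 \<le> w"
  shows "DERIV (ramp L w) x :> L * max 0 (min w x)"
proof -
  have "DERIV (\<lambda>x. (max 0 (x - w))\<^sup>2 / 2) x :> max 0 (x - w) * 1"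
    by (rule DERIV_chain2[OF DERIV_max_square]) (auto intro!: derivative_eq_intros)
  with DERIV_max_square[of x]
  have "DERIV (\<lambda>x. L * ((max 0 x)\<^sup>2 / 2 - (max 0 (x - w))\<^sup>2 / 2)) x
          :> L * (max 0 x - max 0 (x - w) * 1)"
    by (intro DERIV_cmult DERIV_diff)
  moreover have "max 0 x - max 0 (x - w) * 1 = max 0 (min w x)"
    using assms by (auto simp: max_def min_def)
  moreover have "ramp L w = (\<lambda>x. L * ((max 0 x)\<^sup>2 / 2 - (max 0 (x - w))\<^sup>2 / 2))"
    by (intro ext) (rule ramp_def)
  ultimately show ?thesis by (simp only:)
qed

lemma ramp_nonneg: "0 \<le> L \<Longrightarrow> 0 \<le> w \<Longrightarrow> 0 \<le> ramp L w x"
  unfolding ramp_def by (intro mult_nonneg_nonneg) (auto simp: max_def power2_eq_square mult_mono)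

lemma ramp_eq_0: "0 \<le> w \<Longrightarrow> x \<le> 0 \<Longrightarrow> ramp L w x = 0"
  by (auto simp: ramp_def max_def)

lemma ramp_le:
  assumes "0 \<le> L" "0 \<le> w" "0 \<le> x"
  shows "ramp L w x \<le> L * w * x"
proof -
  have "(max 0 x)\<^sup>2 / 2 - (max 0 (x - w))\<^sup>2 / 2 \<le> w * x"
  proof (cases "x \<le> w")
    case True
    then have "x\<^sup>2 / 2 \<le> w * x"
      using assms mult_mono[of x w x x] zero_le_square[of x]
      unfolding power2_eq_square by linarith
    moreover have "max 0 x = x" "max 0 (x - w) = 0" using True assms by auto
    ultimately show ?thesis by simp
  next
    case False
    then show ?thesis using assms by (simp add: max_def power2_eq_square field_simps)
  qed
  then show ?thesis
    unfolding ramp_def mult.assoc using assms(1) by (rule mult_left_mono)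
qed

lemma clip_lipschitz: "\<bar>max 0 (min w x) - max 0 (min w y)\<bar> \<le> \<bar>x - (y::real)\<bar>"
  by (auto simp: max_def min_def)

section \<open>Oracles with multiplicative noise\<close>

lemma measurable_multiplicative_oracle:
  fixes F' N :: "real \<Rightarrow> real" and P :: "real pmf"
  assumes "continuous_on UNIV F'"
  shows "(\<lambda>(x, \<xi>). F' x * N \<xi>) \<in> borel_measurable (borel \<Otimes>\<^sub>M P)"
proof -
  have [measurable]: "F' \<in> borel_measurable borel" "N \<in> borel_measurable P"
    using assms by (auto intro: borel_measurable_continuous_onI)
  show ?thesis by measurable
qed

text \<open>The error at \<open>x\<close> factors as \<open>F' x * (N \<xi> - 1)\<close>, so a
  uniform bound \<open>g\<close> on the slope reduces the moment condition at all points to a single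
  one. Finite support of the noise settles integrability.\<close>

lemma bcm_oracle_multiplicative:
  fixes F F' N :: "real \<Rightarrow> real" and P :: "real pmf"
  assumes F: "\<And>x. DERIV F x :> F' x" and cont: "continuous_on UNIV F'"
    and bound: "\<And>x. \<bar>F' x\<bar> \<le> g"
    and fin: "finite (set_pmf P)"
    and mean: "(\<integral>\<xi>. N \<xi> \<partial>P) = 1"
    and moment: "g powr p * (\<integral>\<xi>. \<bar>N \<xi> - 1\<bar> powr p \<partial>P) \<le> \<sigma> powr p"
    and "0 \<le> p"
  shows "bcm_oracle p \<sigma> P F (\<lambda>x \<xi>. F' x * N \<xi>)"
proof -
  have grad: "gradient F = F'" using F by (intro ext gradient_eqI)
  have norm: "norm (F' x * N \<xi> - F' x) powr p = \<bar>F' x\<bar> powr p * \<bar>N \<xi> - 1\<bar> powr p" for x \<xi>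
  proof -
    have "F' x * N \<xi> - F' x = F' x * (N \<xi> - 1)" by (simp add: algebra_simps)
    then show ?thesis by (simp add: abs_mult powr_mult)
  qed
  have int: "integrable P (f :: real \<Rightarrow> real)" for f
    using fin by (rule integrable_measure_pmf_finite)
  have m: "\<bar>F' x\<bar> powr p * (\<integral>\<xi>. \<bar>N \<xi> - 1\<bar> powr p \<partial>P) \<le> \<sigma> powr p" for x
  proof -
    have "\<bar>F' x\<bar> powr p \<le> g powr p"
      using bound[of x] \<open>0 \<le> p\<close> by (intro powr_mono2) auto
    then have "\<bar>F' x\<bar> powr p * (\<integral>\<xi>. \<bar>N \<xi> - 1\<bar> powr p \<partial>P)
        \<le> g powr p * (\<integral>\<xi>. \<bar>N \<xi> - 1\<bar> powr p \<partial>P)"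
      by (rule mult_right_mono) simp
    also note moment
    finally show ?thesis .
  qed
  have "(\<integral>\<xi>. F' x * N \<xi> \<partial>P) = F' x" for x
    using mean by simp
  moreover have "(\<integral>\<xi>. norm (F' x * N \<xi> - F' x) powr p \<partial>P) \<le> \<sigma> powr p" for x
    using m[of x] by (simp only: norm Bochner_Integration.integral_mult_right_zero)
  ultimately show ?thesis
    unfolding bcm_oracle_def grad
    by (intro conjI allI prob_space_measure_pmf measurable_multiplicative_oracle[OF cont] int)
qed

section \<open>Measurability and pathwise behaviour of the iterates\<close>

lemma prob_space_iid_samples: "prob_space D \<Longrightarrow> prob_space (iid_samples D)"
  unfolding iid_samples_def by (rule prob_space_PiM)

lemma measurable_minibatch_nsgd:
  fixes G :: "real \<Rightarrow> 's \<Rightarrow> real"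
  assumes [measurable]: "(\<lambda>(x, \<xi>). G x \<xi>) \<in> borel_measurable (borel \<Otimes>\<^sub>M D)"
  shows "(\<lambda>\<omega>. minibatch_nsgd G \<eta> b x\<^sub>1 \<omega> t) \<in> borel_measurable (iid_samples D)"
proof (induction t)
  case (Suc t)
  note [measurable] = Suc
  have [measurable]: "(\<lambda>\<omega>. \<omega> i) \<in> measurable (iid_samples D) D" for i
    unfolding iid_samples_def by simp
  have [measurable]: "(\<lambda>\<omega>. G (minibatch_nsgd G \<eta> b x\<^sub>1 \<omega> t) (\<omega> i))
      \<in> borel_measurable (iid_samples D)" for i
    using measurable_compose[OF measurable_Pair[OF Suc \<open>(\<lambda>\<omega>. \<omega> i) \<in> _\<close>] assms] by simp
  show ?case by (cases "t = 0") (simp_all add: Let_def)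
qed simp

text \<open>If all noise factors of a batch agree, their common value \<open>k\<close> can be pulled
  out of the mean, and normalisation keeps only signs. The condition \<open>1 \<le> t\<close>
  excludes the dummy index 0, from which no step is taken.\<close>

lemma minibatch_nsgd_step:
  fixes F' :: "real \<Rightarrow> real" and N :: "'s \<Rightarrow> real"
  assumes "1 \<le> t" and "\<And>j. j \<in> {1..b t} \<Longrightarrow> N (\<omega> (t, j)) = k" and "1 \<le> b t"
  shows "minibatch_nsgd (\<lambda>x \<xi>. F' x * N \<xi>) \<eta> b x\<^sub>1 \<omega> (Suc t)
       = minibatch_nsgd (\<lambda>x \<xi>. F' x * N \<xi>) \<eta> b x\<^sub>1 \<omega> t
         - \<eta> t * (sgn (F' (minibatch_nsgd (\<lambda>x \<xi>. F' x * N \<xi>) \<eta> b x\<^sub>1 \<omega> t)) * sgn k)"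
proof -
  have "(1 / real (b t)) * (\<Sum>j=1..b t. y * N (\<omega> (t, j))) = y * k" for y
  proof -
    have "(\<Sum>j=1..b t. y * N (\<omega> (t, j))) = (\<Sum>j=1..b t. y * k)"
      using assms(2) by (intro sum.cong) auto
    then show ?thesis using \<open>1 \<le> b t\<close> by simp
  qed
  moreover have "t \<noteq> 0" using assms(1) by simp
  ultimately show ?thesis
    by (simp only: minibatch_nsgd.simps if_False Let_def real_scaleR_def sgn_mult)
qed

lemma minibatch_nsgd_step_ge:
  fixes G :: "real \<Rightarrow> 's \<Rightarrow> real"
  assumes "1 \<le> t" "0 \<le> \<eta> t"
  shows "minibatch_nsgd G \<eta> b x\<^sub>1 \<omega> (Suc t) \<ge> minibatch_nsgd G \<eta> b x\<^sub>1 \<omega> t - \<eta> t"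
proof -
  have "\<eta> t * sgn y \<le> \<eta> t" for y :: real
    using assms(2) by (auto simp: sgn_if)
  then show ?thesis using assms by (simp add: Let_def)
qed

text \<open>Normalisation limits each move to \<open>h\<close> whatever the oracle answers. The
  iterate with index \<open>t\<close> has made only \<open>t - 1\<close> moves.\<close>

lemma nsgd_ge_linear:
  fixes G :: "real \<Rightarrow> 's \<Rightarrow> real"
  assumes "0 \<le> h" "1 \<le> t"
  shows "minibatch_nsgd G (\<lambda>_. h) b x\<^sub>1 \<omega> t \<ge> x\<^sub>1 - h * (real t - 1)"
  using \<open>1 \<le> t\<close>
proof (induction t rule: dec_induct)
  case (step n)
  then show ?case
    using minibatch_nsgd_step_ge[of n "\<lambda>_. h" G b x\<^sub>1 \<omega>] assms(1) by (simp add: algebra_simps)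
qed simp

text \<open>The slopes at the two points have opposite signs, so an exact step of length
  \<open>h\<close> from either one lands on the other.\<close>

lemma nsgd_oscillates:
  fixes F' :: "real \<Rightarrow> real"
  assumes "0 < F' x\<^sub>1" "F' (x\<^sub>1 - h) < 0" "\<And>t. 1 \<le> b t" "1 \<le> t"
  shows "minibatch_nsgd (\<lambda>x _. F' x) (\<lambda>_. h) b x\<^sub>1 \<omega> t \<in> {x\<^sub>1, x\<^sub>1 - h}"
  using \<open>1 \<le> t\<close>
proof (induction t rule: dec_induct)
  case (step n)
  then show ?case
    using minibatch_nsgd_step[of n b "\<lambda>_. 1" \<omega> 1 F' "\<lambda>_. h" x\<^sub>1] assms
    by (auto simp del: minibatch_nsgd.simps)
qed simp

section \<open>Two-point noise and its moments\<close>

text \<open>The rare value is chosen to give mean 1: \<delta> * (2 - \<delta>) / \<delta> - (1 -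
  \<delta>) = 1.\<close>

definition two_point :: "real \<Rightarrow> real pmf" where
  "two_point \<delta> = map_pmf (\<lambda>b. if b then (2 - \<delta>) / \<delta> else - 1) (bernoulli_pmf \<delta>)"

lemma finite_set_two_point: "finite (set_pmf (two_point \<delta>))"
  by (simp add: two_point_def)

lemma integral_two_point:
  fixes f :: "real \<Rightarrow> real"
  assumes "0 < \<delta>" "\<delta> \<le> 1"
  shows "(\<integral>\<xi>. f \<xi> \<partial>two_point \<delta>) = \<delta> * f ((2 - \<delta>) / \<delta>) + (1 - \<delta>) * f (- 1)"
  using assms by (simp add: two_point_def)

lemma mean_two_point: "0 < \<delta> \<Longrightarrow> \<delta> \<le> 1 \<Longrightarrow> (\<integral>\<xi>. \<xi> \<partial>two_point \<delta>) = 1"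
  by (simp add: integral_two_point)

text \<open>The rare value deviates from 1 by at most 2/\<delta> and contributes at most
  \<open>4 * \<delta> powr (1 - p)\<close>. The value -1 deviates by 2 and contributes at most 4,
  which is no larger than the same bound because \<delta> \<le> 1 < \<open>p\<close>.\<close>

lemma moment_two_point:
  assumes "0 < \<delta>" "\<delta> \<le> 1" "1 < p" "p \<le> 2"
  shows "(\<integral>\<xi>. \<bar>\<xi> - 1\<bar> powr p \<partial>two_point \<delta>) \<le> 8 * \<delta> powr (1 - p)"
proof -
  have two: "2 powr p \<le> (4::real)"
    using powr_mono[of p 2 "2::real"] assms by simp
  have "\<bar>(2 - \<delta>) / \<delta> - 1\<bar> powr p \<le> (2 / \<delta>) powr p"
    using assms by (intro powr_mono2) (auto simp: field_simps)
  then have "\<delta> * \<bar>(2 - \<delta>) / \<delta> - 1\<bar> powr p \<le> \<delta> * (2 powr p * \<delta> powr (- p))"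
    using assms by (intro mult_left_mono) (auto simp: powr_divide powr_minus_divide)
  also have "\<dots> = 2 powr p * \<delta> powr (1 - p)"
    using assms by (simp add: powr_diff powr_minus divide_inverse)
  finally have 1: "\<delta> * \<bar>(2 - \<delta>) / \<delta> - 1\<bar> powr p \<le> 4 * \<delta> powr (1 - p)"
    using mult_right_mono[OF two powr_ge_zero[of \<delta> "1 - p"]] by linarith
  have "1 \<le> \<delta> powr (1 - p)"
    using powr_mono2'[of "1 - p" \<delta> 1] assms by simp
  moreover have "(1 - \<delta>) * \<bar>- 1 - 1\<bar> powr p \<le> 1 * 4"
    using two assms by (intro mult_mono) auto
  ultimately show ?thesis
    using 1 by (subst integral_two_point) (use assms in auto)
qed

section \<open>Exponential moments and upward drift\<close>

text \<open>The product looks at finitely many coordinates only, so the infinite product measure may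
  be replaced by its marginal on \<open>J\<close>, where the integral factorises.\<close>

lemma product_iid_samples:
  fixes f :: "'s \<Rightarrow> real"
  assumes "prob_space D" "finite J" and f: "integrable D f"
  shows "integrable (iid_samples D) (\<lambda>\<omega>. \<Prod>i\<in>J. f (\<omega> i))"
    and "(\<integral>\<omega>. (\<Prod>i\<in>J. f (\<omega> i)) \<partial>iid_samples D) = (\<integral>\<xi>. f \<xi> \<partial>D) ^ card J"
proof -
  interpret product_prob_space "\<lambda>_. D" UNIV
    using assms(1) by (rule product_prob_spaceI)
  have eq: "distr (iid_samples D) (PiM J (\<lambda>_. D)) (\<lambda>x. restrict x J) = PiM J (\<lambda>_. D)"
    unfolding iid_samples_def using assms(2) by (intro distr_PiM_restrict_finite) auto
  have meas: "(\<lambda>x. restrict x J) \<in> measurable (iid_samples D) (PiM J (\<lambda>_. D))"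
    unfolding iid_samples_def by (intro measurable_restrict_subset) auto
  have cong: "(\<Prod>i\<in>J. f (restrict \<omega> J i)) = (\<Prod>i\<in>J. f (\<omega> i))" for \<omega> :: "_ \<Rightarrow> 's"
    by (intro prod.cong) auto
  have int: "integrable (PiM J (\<lambda>_. D)) (\<lambda>\<omega>. \<Prod>i\<in>J. f (\<omega> i))"
    using assms(2) f by (rule product_integrable_prod)
  then show "integrable (iid_samples D) (\<lambda>\<omega>. \<Prod>i\<in>J. f (\<omega> i))"
    using integrable_distr[OF meas, of "\<lambda>\<omega>. \<Prod>i\<in>J. f (\<omega> i)"] unfolding eq cong by simp
  have "(\<integral>\<omega>. (\<Prod>i\<in>J. f (\<omega> i)) \<partial>PiM J (\<lambda>_. D)) = (\<integral>\<omega>. (\<Prod>i\<in>J. f (\<omega> i)) \<partial>iid_samples D)"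
    using integral_distr[OF meas, of "\<lambda>\<omega>. \<Prod>i\<in>J. f (\<omega> i)"] int unfolding eq cong
    by (simp add: borel_measurable_integrable)
  then show "(\<integral>\<omega>. (\<Prod>i\<in>J. f (\<omega> i)) \<partial>iid_samples D) = (\<integral>\<xi>. f \<xi> \<partial>D) ^ card J"
    using product_integral_prod[OF assms(2), of "\<lambda>_. f"] f by simp
qed

text \<open>As long as the walk is nonnegative, the iterate is at least \<open>x\<^sub>1\<close>,
  where the slope is \<open>g > 0\<close>; a batch consisting of -1 only then moves it up by exactly
  \<open>h\<close>. The walk has index \<open>t - 1\<close> because iterate 1 precedes all
  steps.\<close>

lemma nsgd_drift:
  fixes F' :: "real \<Rightarrow> real" and b :: nat and \<omega> :: "nat \<times> nat \<Rightarrow> real" and h x\<^sub>1 :: real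
  defines "x \<equiv> minibatch_nsgd (\<lambda>x \<xi>. F' x * \<xi>) (\<lambda>_. h) (\<lambda>_. b) x\<^sub>1 \<omega>"
  defines "S \<equiv> \<lambda>s. \<Sum>i=1..s. if \<forall>j\<in>{1..b}. \<omega> (i, j) = - 1 then 1 else - 1 :: real"
  assumes "0 < h" "0 < g" "1 \<le> b" and slope: "\<And>y. x\<^sub>1 \<le> y \<Longrightarrow> F' y = g"
    and nonneg: "\<And>s. s < t \<Longrightarrow> 0 \<le> S s" and "1 \<le> t"
  shows "x\<^sub>1 + h * S (t - 1) \<le> x t"
  using \<open>1 \<le> t\<close> nonneg
proof (induction t rule: dec_induct)
  case base
  then show ?case by (simp add: x_def S_def)
next
  case (step n)
  have IH: "x\<^sub>1 + h * S (n - 1) \<le> x n"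
    using step by auto
  have "0 \<le> S (n - 1)" using step by auto
  then have ge: "x\<^sub>1 \<le> x n"
    using IH \<open>0 < h\<close> mult_nonneg_nonneg[of h "S (n - 1)"] by linarith
  obtain m where m: "n = Suc m" using step(1) by (cases n) auto
  show ?case
  proof (cases "\<forall>j\<in>{1..b}. \<omega> (n, j) = - 1")
    case True
    then have "x (Suc n) = x n + h"
      using minibatch_nsgd_step[of n "\<lambda>_. b" "\<lambda>\<xi>. \<xi>" \<omega> "- 1" F' "\<lambda>_. h" x\<^sub>1]
        step(1) slope[OF ge] \<open>0 < g\<close> \<open>1 \<le> b\<close> unfolding x_def by simp
    moreover have "S n = S (n - 1) + 1"
      using True by (simp add: S_def m)
    ultimately show ?thesis using IH by (simp add: algebra_simps)
  next
    case False
    \<comment> \<open>Any other batch may point either way and is charged as a full step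
      downhill.\<close>
    have "x (Suc n) \<ge> x n - h"
      unfolding x_def by (rule minibatch_nsgd_step_ge) (use step(1) \<open>0 < h\<close> in auto)
    moreover have "S n = S (n - 1) - 1"
      using False by (simp add: S_def m)
    then have "h * S n = h * S (n - 1) - h" by (simp only: right_diff_distrib mult_1_right)
    ultimately show ?thesis using IH by simp
  qed
qed

text \<open>A step of the walk contributes 1/4 if the batch is all -1, and 4 = 1/4 * 16 otherwise.
  Giving weight 16 to every sample different from -1 can only overestimate this, and it yields a
  product over independent samples.\<close>

lemma exponential_weight_ge:
  fixes \<omega> :: "nat \<times> nat \<Rightarrow> real"
  shows "(1/4::real) powr (\<Sum>i=1..s. if \<forall>j\<in>{1..b}. \<omega> (i, j) = - 1 then 1 else - 1)
    \<le> (1/4) ^ s * (\<Prod>ij\<in>{1..s} \<times> {1..b}. if \<omega> ij = - 1 then 1 else 16)"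
proof -
  let ?w = "\<lambda>ij. if \<omega> ij = - 1 then 1 else 16 :: real"
  have "(1/4::real) powr (if \<forall>j\<in>{1..b}. \<omega> (i, j) = - 1 then 1 else - 1)
      \<le> 1/4 * (\<Prod>j=1..b. ?w (i, j))" (is "?l i \<le> ?r i") for i
  proof (cases "\<forall>j\<in>{1..b}. \<omega> (i, j) = - 1")
    case True
    then show ?thesis by simp
  next
    case False
    then obtain k where k: "k \<in> {1..b}" "\<omega> (i, k) \<noteq> - 1" by blast
    have "(\<Prod>j=1..b. ?w (i, j)) = ?w (i, k) * (\<Prod>j\<in>{1..b} - {k}. ?w (i, j))"
      using k(1) by (intro prod.remove) auto
    moreover have "1 \<le> (\<Prod>j\<in>{1..b} - {k}. ?w (i, j))"
      by (intro prod_ge_1) auto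
    ultimately show ?thesis using False k by (simp add: powr_minus_divide del: prod.remove)
  qed
  then have "(\<Prod>i=1..s. ?l i) \<le> (\<Prod>i=1..s. ?r i)"
    by (intro prod_mono) auto
  moreover have "(\<Prod>i=1..s. ?l i) = (1/4) powr (\<Sum>i=1..s. if \<forall>j\<in>{1..b}. \<omega> (i, j) = - 1 then 1 else - 1)"
    by (induction s) (auto simp: powr_add)
  moreover have "(\<Prod>i=1..s. ?r i) = (1/4) ^ s * (\<Prod>ij\<in>{1..s} \<times> {1..b}. ?w ij)"
    by (simp only: prod.distrib prod_constant prod.cartesian_product) (simp add: case_prod_beta)
  ultimately show ?thesis by linarith
qed

text \<open>The union bound is carried out by integrating one pathwise inequality: each
  \<open>Z s\<close> is nonnegative and is at least 1 when the walk is negative at time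
  \<open>s\<close>. The means of \<open>Z s\<close> for \<open>s \<ge> 1\<close> sum to at most 1/4,
  which leaves 3/4 of the slope.\<close>

lemma expectation_gradient_drift:
  fixes F' :: "real \<Rightarrow> real"
  assumes "0 < h" "0 < g" "1 \<le> b" "1 \<le> t" "0 < \<delta>" "\<delta> * real b \<le> 1/32"
    and cont: "continuous_on UNIV F'"
    and slope: "\<And>y. x\<^sub>1 \<le> y \<Longrightarrow> F' y = g" and range: "\<And>y. F' y \<in> {0..g}"
  shows "(\<integral>\<omega>. \<bar>F' (minibatch_nsgd (\<lambda>x \<xi>. F' x * \<xi>) (\<lambda>_. h) (\<lambda>_. b) x\<^sub>1 \<omega> t)\<bar>
      \<partial>iid_samples (two_point \<delta>)) \<ge> 3/4 * g"
proof -
  define x where "x = minibatch_nsgd (\<lambda>x \<xi>. F' x * \<xi>) (\<lambda>_. h) (\<lambda>_. b) x\<^sub>1"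
  define M where "M = iid_samples (two_point \<delta>)"
  define S :: "(nat \<times> nat \<Rightarrow> real) \<Rightarrow> nat \<Rightarrow> real" where
    "S = (\<lambda>\<omega> s. \<Sum>i=1..s. if \<forall>j\<in>{1..b}. \<omega> (i, j) = - 1 then 1 else - 1)"
  define w :: "real \<Rightarrow> real" where "w = (\<lambda>\<xi>. if \<xi> = - 1 then 1 else 16)"
  define Z where "Z = (\<lambda>s \<omega>. 1/4 * ((1/4) ^ s * (\<Prod>ij\<in>{1..s} \<times> {1..b}. w (\<omega> ij))))"
  interpret prob_space M
    unfolding M_def by (intro prob_space_iid_samples prob_space_measure_pmf)
  have \<delta>: "\<delta> \<le> 1"
  proof -
    have "\<delta> * 1 \<le> \<delta> * real b" using assms by (intro mult_left_mono) auto
    then show ?thesis using assms by linarith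
  qed
  have int_w: "integrable (two_point \<delta>) w"
    by (intro integrable_measure_pmf_finite finite_set_two_point)
  have mean_w: "(\<integral>\<xi>. w \<xi> \<partial>two_point \<delta>) = 1 + 15 * \<delta>"
  proof -
    \<comment> \<open>The rare value differs from -1 and so receives the weight 16; the mean is 16 *
      \<delta> + (1 - \<delta>).\<close>
    have "(2 - \<delta>) / \<delta> \<noteq> - 1" using \<open>0 < \<delta>\<close> by (simp add: field_simps)
    then show ?thesis using \<open>0 < \<delta>\<close> \<delta> by (simp add: integral_two_point w_def)
  qed
  have int_Z: "integrable M (Z s)" for s
    unfolding Z_def M_def
    by (intro integrable_mult_right product_iid_samples prob_space_measure_pmf int_w) auto
  have EZ: "(\<integral>\<omega>. Z s \<omega> \<partial>M) \<le> 1/4 * (1/2) ^ s" for s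
  proof -
    have "(\<integral>\<omega>. (\<Prod>ij\<in>{1..s} \<times> {1..b}. w (\<omega> ij)) \<partial>M) = ((1 + 15 * \<delta>) ^ b) ^ s"
      using product_iid_samples(2)[OF prob_space_measure_pmf _ int_w, of "{1..s} \<times> {1..b}"]
      by (simp add: M_def mean_w power_mult[of _ b s] mult.commute[of s b])
    also have "\<dots> \<le> 2 ^ s"
    \<comment> \<open>Here \<delta> * \<open>b\<close> \<le> 1/32 enters: a batch has mean weight at
      most exp (15/32) \<le> 2. Together with the factor 1/4 per step this gives the decay rate
      1/2.\<close>
    proof (intro power_mono)
      have "(1 + 15 * \<delta>) ^ b \<le> exp (15 * \<delta>) ^ b"
        using \<open>0 < \<delta>\<close> by (intro power_mono) auto
      also have "\<dots> = exp (15 * (\<delta> * b))" by (metis exp_of_nat_mult mult.assoc mult.commute)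
      also have "\<dots> \<le> exp (1/2)" using assms by simp
      also have "\<dots> \<le> 2" using exp_bound[of "1/2"] by (simp add: power2_eq_square)
      finally show "(1 + 15 * \<delta>) ^ b \<le> 2" .
    qed (use \<open>0 < \<delta>\<close> in auto)
    finally have "(1/4) ^ s * (\<integral>\<omega>. (\<Prod>ij\<in>{1..s} \<times> {1..b}. w (\<omega> ij)) \<partial>M) \<le> (1/4) ^ s * 2 ^ s"
      by (intro mult_left_mono) auto
    also have "\<dots> = (1/2) ^ s" by (simp add: power_mult_distrib[symmetric])
    finally show ?thesis by (simp add: Z_def)
  qed
  have Z_nonneg: "0 \<le> Z s \<omega>" for s \<omega>
    unfolding Z_def by (intro mult_nonneg_nonneg prod_nonneg) (auto simp: w_def)
  \<comment> \<open>\<open>Z s\<close> dominates \<open>(1/4)\<close> to the power \<open>1 + S s\<close>, and \<open>S\<close> is integer valued.\<close>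
  have Z_ge: "1 \<le> Z s \<omega>" if "S \<omega> s < 0" for s \<omega>
  proof -
    have "S \<omega> s \<le> - 1"
    proof -
      have "S \<omega> s \<in> \<int>" unfolding S_def by (intro Ints_sum) auto
      then obtain k where "S \<omega> s = of_int k" by (elim Ints_cases)
      then show ?thesis using that by simp
    qed
    then have "1/4 * (1/4) powr (- 1) \<le> 1/4 * (1/4::real) powr S \<omega> s"
      by (intro mult_left_mono powr_mono') auto
    also have "\<dots> \<le> Z s \<omega>"
      unfolding Z_def S_def w_def by (intro mult_left_mono exponential_weight_ge) auto
    finally show ?thesis by (simp add: powr_minus_divide)
  qed
  have pathwise: "g * (1 - (\<Sum>s=1..t. Z s \<omega>)) \<le> \<bar>F' (x \<omega> t)\<bar>" for \<omega>
  proof (cases "\<forall>s<t. 0 \<le> S \<omega> s")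
    case True
    then have "x\<^sub>1 + h * S \<omega> (t - 1) \<le> x \<omega> t"
      using nsgd_drift[of h g b x\<^sub>1 F' t \<omega>] assms unfolding x_def S_def by blast
    moreover have "0 \<le> h * S \<omega> (t - 1)"
      using True assms by auto
    ultimately have "F' (x \<omega> t) = g" by (intro slope) linarith
    moreover have "g * (1 - (\<Sum>s=1..t. Z s \<omega>)) \<le> g * 1"
      using assms by (intro mult_left_mono) (auto intro!: sum_nonneg Z_nonneg)
    ultimately show ?thesis using assms by simp
  next
    case False
    then obtain s where s: "s < t" "S \<omega> s < 0" by force
    \<comment> \<open>The empty walk has value 0, so a negative time lies in the range
      1..\<open>t\<close> of the sum.\<close>
    then have "s \<noteq> 0" by (intro notI) (simp add: S_def)
    with s have "Z s \<omega> \<le> (\<Sum>s=1..t. Z s \<omega>)"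
      by (intro member_le_sum) (auto simp: Z_nonneg)
    with Z_ge[OF s(2)] have "g * (1 - (\<Sum>s=1..t. Z s \<omega>)) \<le> 0"
      using assms by (intro mult_nonneg_nonpos) auto
    then show ?thesis by linarith
  qed
  have [measurable]: "F' \<in> borel_measurable borel"
    using cont by (rule borel_measurable_continuous_onI)
  have [measurable]: "(\<lambda>\<omega>. x \<omega> t) \<in> borel_measurable M"
    unfolding x_def M_def
    by (intro measurable_minibatch_nsgd measurable_multiplicative_oracle[OF cont])
  have int_F: "integrable M (\<lambda>\<omega>. \<bar>F' (x \<omega> t)\<bar>)"
    using range by (intro integrable_const_bound[where B = g]) auto
  have "(\<Sum>s=1..t. (\<integral>\<omega>. Z s \<omega> \<partial>M)) \<le> (\<Sum>s=1..t. 1/4 * (1/2) ^ s)"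
    by (intro sum_mono EZ)
  also have "\<dots> = 1/4 - 1/4 * (1/2) ^ t"
    by (induction t) auto
  also have "\<dots> \<le> 1/4" by simp
  finally have "(\<Sum>s=1..t. (\<integral>\<omega>. Z s \<omega> \<partial>M)) \<le> 1/4" .
  then have "3/4 * g \<le> g * (1 - (\<Sum>s=1..t. (\<integral>\<omega>. Z s \<omega> \<partial>M)))"
    using assms by (simp add: mult.commute)
  also have "\<dots> = (\<integral>\<omega>. g * (1 - (\<Sum>s=1..t. Z s \<omega>)) \<partial>M)"
    using int_Z by (simp add: Bochner_Integration.integral_diff Bochner_Integration.integral_sum prob_space)
  also have "\<dots> \<le> (\<integral>\<omega>. \<bar>F' (x \<omega> t)\<bar> \<partial>M)"
    using int_Z int_F pathwise by (intro integral_mono) auto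
  finally show ?thesis by (simp add: x_def M_def)
qed

section \<open>From bounds on horizon or batch size to sample counts\<close>

lemma batch_size_ge_1: "1 \<le> batch_size B q T"
  unfolding batch_size_def by linarith

lemma batch_size_ge: "B * real T powr q \<le> batch_size B q T"
  unfolding batch_size_def by linarith

text \<open>The maximum with 1 and the rounding cost at most 2, which is absorbed by 2 * T^q since
  T^q \<ge> 1.\<close>

lemma batch_size_le:
  assumes "0 < B" "0 < q" "1 \<le> T"
  shows "batch_size B q T \<le> (2 + B) * real T powr q"
proof -
  have "1 \<le> real T powr q" using assms by (intro ge_one_powr_ge_zero) auto
  moreover from this have "0 \<le> B * real T powr q" using assms by simp
  ultimately have "max 1 (B * real T powr q) + 1 \<le> (2 + B) * real T powr q"
    unfolding distrib_right by linarith
  then show ?thesis unfolding batch_size_def by linarith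
qed

text \<open>The sample count is at least \<open>B\<close> * T^(1+q), so a lower bound on T^a is
  raised to the power (1+q)/a. It serves a = 1-r for the path length and a = r for the step
  size.\<close>

lemma samples_ge_of_horizon:
  assumes "0 < B" "0 < q" "1 \<le> T" "0 < a" "0 \<le> k" "0 \<le> Y" and T: "k * Y \<le> real T powr a"
  shows "B * k powr ((1 + q) / a) * Y powr ((1 + q) / a) \<le> real (T * batch_size B q T)"
proof -
  have "B * k powr ((1 + q) / a) * Y powr ((1 + q) / a) = B * (k * Y) powr ((1 + q) / a)"
    using assms by (simp add: powr_mult)
  also have "\<dots> \<le> B * (real T powr a) powr ((1 + q) / a)"
    using assms by (intro mult_left_mono powr_mono2) auto
  also have "\<dots> = real T * (B * real T powr q)"
    using assms by (simp add: powr_powr powr_add)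
  also have "\<dots> \<le> real T * batch_size B q T"
    by (intro mult_left_mono batch_size_ge) auto
  finally show ?thesis by simp
qed

text \<open>A batch of size b forces T \<ge> (b / (2+B))^(1/q), hence T * b is at least b^(1+1/q) up
  to a constant.\<close>

lemma samples_ge_of_batch:
  fixes k Y :: real
  assumes "0 < B" "0 < q" "1 \<le> T" "0 \<le> k" "0 \<le> Y" and b: "k * Y \<le> batch_size B q T"
  shows "k powr (1 + 1 / q) / (2 + B) powr (1 / q) * Y powr (1 + 1 / q)
    \<le> real (T * batch_size B q T)"
proof -
  define b where "b = real (batch_size B q T)"
  have "1 \<le> b" using batch_size_ge_1[of B q T] by (simp add: b_def)
  have "b powr (1 / q) \<le> ((2 + B) * real T powr q) powr (1 / q)"
    unfolding b_def using batch_size_le[of B q T] assms by (intro powr_mono2) auto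
  also have "\<dots> = (2 + B) powr (1 / q) * real T"
    using assms by (simp add: powr_mult powr_powr)
  finally have T: "b powr (1 / q) / (2 + B) powr (1 / q) \<le> T"
    using assms by (simp add: field_simps)
  have "k powr (1 + 1 / q) / (2 + B) powr (1 / q) * Y powr (1 + 1 / q)
      = (k * Y) powr (1 + 1 / q) / (2 + B) powr (1 / q)"
    using assms by (simp add: powr_mult)
  also have "\<dots> \<le> b powr (1 + 1 / q) / (2 + B) powr (1 / q)"
    using assms by (intro divide_right_mono powr_mono2) (auto simp: b_def)
  also have "\<dots> = b powr (1 / q) / (2 + B) powr (1 / q) * b"
    using \<open>1 \<le> b\<close> by (simp add: powr_add)
  also have "\<dots> \<le> T * b" using T \<open>1 \<le> b\<close> by (intro mult_right_mono) auto
  finally show ?thesis by (simp add: b_def)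
qed

section \<open>The three hard instances\<close>

lemma bcm_oracle_deterministic:
  assumes "\<And>x. DERIV F x :> F' x" "continuous_on UNIV F'" "\<And>x. \<bar>F' x\<bar> \<le> g" "0 \<le> p"
  shows "bcm_oracle p \<sigma> (return_pmf (0::real)) F (\<lambda>x _. F' x)"
  using bcm_oracle_multiplicative[of F F' g "return_pmf 0" "\<lambda>_. 1" p \<sigma>] assms by simp

text \<open>The existential conclusion of the theorem, with step length \<open>h\<close> and batch
  size \<open>b\<close> detached from the horizon, as a common target for the three
  obstructions.\<close>

definition hard_instance ::
    "real \<Rightarrow> real \<Rightarrow> real \<Rightarrow> real \<Rightarrow> real \<Rightarrow> real \<Rightarrow> nat \<Rightarrow> nat \<Rightarrow> real \<Rightarrow> bool" where
  "hard_instance p \<sigma> L \<Delta> \<epsilon> h b T x\<^sub>1 \<longleftrightarrow>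
     (\<exists>(F :: real \<Rightarrow> real) (D :: real measure) G.
        smooth_fun L F \<and> bdd_below (range F) \<and> F x\<^sub>1 - (INF x. F x) \<le> \<Delta> \<and> bcm_oracle p \<sigma> D F G \<and>
        (\<forall>t\<in>{1..T}. (\<integral>\<omega>. norm (gradient F (minibatch_nsgd G (\<lambda>_. h) (\<lambda>_. b) x\<^sub>1 \<omega> t))
           \<partial>iid_samples D) > \<epsilon>))"

lemma hard_instanceI:
  fixes F F' :: "real \<Rightarrow> real" and D :: "real measure"
  assumes F: "\<And>x. DERIV F x :> F' x" and "\<And>x y. \<bar>F' x - F' y\<bar> \<le> L * \<bar>x - y\<bar>"
    and nonneg: "\<And>x. 0 \<le> F x" and "F x\<^sub>1 \<le> \<Delta>" and "bcm_oracle p \<sigma> D F G"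
    and "\<And>t. 1 \<le> t \<Longrightarrow> t \<le> T \<Longrightarrow>
      (\<integral>\<omega>. \<bar>F' (minibatch_nsgd G (\<lambda>_. h) (\<lambda>_. b) x\<^sub>1 \<omega> t)\<bar> \<partial>iid_samples D) > \<epsilon>"
  shows "hard_instance p \<sigma> L \<Delta> \<epsilon> h b T x\<^sub>1"
proof -
  have "gradient F = F'" using F by (intro ext gradient_eqI)
  moreover have "0 \<le> (INF x. F x)" using nonneg by (intro cINF_greatest) auto
  moreover have "bdd_below (range F)" using nonneg by (intro bdd_belowI2)
  moreover have "smooth_fun L F" using assms(1,2) by (rule smooth_funI)
  ultimately show ?thesis
    unfolding hard_instance_def using assms
    by (intro exI[of _ F] exI[of _ D] exI[of _ G]) auto
qed

definition ramp_slope :: "real \<Rightarrow> real \<Rightarrow> real \<Rightarrow> real" where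
  "ramp_slope L w x = L * max 0 (min w x)"

lemma DERIV_ramp_shift: "0 \<le> w \<Longrightarrow> DERIV (\<lambda>x. ramp L w (x - a)) x :> ramp_slope L w (x - a)"
  unfolding ramp_slope_def
  by (rule DERIV_chain2[OF DERIV_ramp, where Db = 1, simplified])
    (auto intro!: derivative_eq_intros)

lemma ramp_slope_lipschitz:
  "0 \<le> L \<Longrightarrow> \<bar>ramp_slope L w (x - a) - ramp_slope L w (y - a)\<bar> \<le> L * \<bar>x - y\<bar>"
  using clip_lipschitz[of w "x - a" "y - a"]
  by (simp add: ramp_slope_def right_diff_distrib[symmetric] abs_mult mult_left_mono)

lemma continuous_ramp_slope: "continuous_on UNIV (\<lambda>x. ramp_slope L w (x - a))"
  unfolding ramp_slope_def by (intro continuous_intros)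

lemma ramp_slope_bounds: "0 \<le> L \<Longrightarrow> 0 \<le> w \<Longrightarrow> ramp_slope L w x \<in> {0..L * w}"
  by (auto simp: ramp_slope_def intro!: mult_left_mono mult_nonneg_nonneg)

lemma ramp_slope_eq: "0 \<le> w \<Longrightarrow> w \<le> x \<Longrightarrow> ramp_slope L w x = L * w"
  by (simp add: ramp_slope_def)

text \<open>All iterates stay within distance \<open>h * T\<close> to the left of
  \<open>x\<^sub>1\<close> or lie to its right, so a ramp that is already linear from
  \<open>x\<^sub>1 - h * T\<close> on shows them only the slope 2\<epsilon>.\<close>

lemma hard_instance_short_path:
  assumes "0 < L" "0 < \<epsilon>" "0 \<le> h" "0 \<le> p"
    and small: "4 * \<epsilon>\<^sup>2 / L \<le> \<Delta> / 2" and path: "2 * \<epsilon> * (h * real T) \<le> \<Delta> / 2"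
  shows "hard_instance p \<sigma> L \<Delta> \<epsilon> h b T x\<^sub>1"
proof -
  \<comment> \<open>The shortest interval on which an \<open>L\<close>-Lipschitz slope can grow from
    0 to 2\<epsilon>.\<close>
  define w where "w = 2 * \<epsilon> / L"
  have w: "0 \<le> w" "L * w = 2 * \<epsilon>" using assms by (auto simp: w_def)
  define a where "a = x\<^sub>1 - h * T - w"
  have bounds: "ramp_slope L w (x - a) \<in> {0..2 * \<epsilon>}" for x
    using ramp_slope_bounds[of L w "x - a"] assms w by simp
  then have abs_bound: "\<bar>ramp_slope L w (x - a)\<bar> \<le> 2 * \<epsilon>" for x
    by (simp add: abs_of_nonneg)
  show ?thesis
  proof (rule hard_instanceI)
    show "DERIV (\<lambda>x. ramp L w (x - a)) x :> ramp_slope L w (x - a)" for x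
      using w by (intro DERIV_ramp_shift)
    then show "bcm_oracle p \<sigma> (return_pmf (0::real)) (\<lambda>x. ramp L w (x - a)) (\<lambda>x _. ramp_slope L w (x - a))"
      using continuous_ramp_slope abs_bound \<open>0 \<le> p\<close> by (rule bcm_oracle_deterministic)
    have "ramp L w (x\<^sub>1 - a) \<le> L * w * (h * T + w)"
      using ramp_le[of L w "x\<^sub>1 - a"] assms w by (simp add: a_def)
    also have "\<dots> = 2 * \<epsilon> * (h * T) + 4 * \<epsilon>\<^sup>2 / L"
      unfolding w(2) by (simp add: w_def power2_eq_square algebra_simps)
    finally show "ramp L w (x\<^sub>1 - a) \<le> \<Delta>" using small path by linarith
    fix t :: nat
    assume t: "1 \<le> t" "t \<le> T"
    interpret prob_space "iid_samples (return_pmf (0::real))"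
      by (intro prob_space_iid_samples prob_space_measure_pmf)
    have "ramp_slope L w (minibatch_nsgd (\<lambda>x _. ramp_slope L w (x - a)) (\<lambda>_. h) (\<lambda>_. b) x\<^sub>1 \<omega> t - a)
        = 2 * \<epsilon>" (is "ramp_slope L w (?x - a) = _") for \<omega> :: "nat \<times> nat \<Rightarrow> real"
    proof -
      have "?x \<ge> x\<^sub>1 - h * (real t - 1)" using assms t by (intro nsgd_ge_linear) auto
      moreover have "h * (real t - 1) \<le> h * real T" using assms t by (intro mult_left_mono) auto
      ultimately show ?thesis using w by (subst ramp_slope_eq) (auto simp: a_def)
    qed
    then show "\<epsilon> < (\<integral>\<omega>. \<bar>ramp_slope L w (minibatch_nsgd (\<lambda>x _. ramp_slope L w (x - a))
        (\<lambda>_. h) (\<lambda>_. b) x\<^sub>1 \<omega> t - a)\<bar> \<partial>iid_samples (return_pmf (0::real)))"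
      using \<open>0 < \<epsilon>\<close> by (simp add: prob_space)
  qed (use assms w in \<open>auto intro: ramp_nonneg ramp_slope_lipschitz\<close>)
qed

text \<open>Two mirrored ramps form a Huber function centred midway between \<open>x\<^sub>1\<close>
  and \<open>x\<^sub>1 - h\<close>. The assumption \<open>large\<close> makes both points lie
  outside its quadratic part, where the slopes are 2\<epsilon> and -2\<epsilon>.\<close>

lemma hard_instance_oscillation:
  assumes "0 < L" "0 < \<epsilon>" "0 \<le> p" "1 \<le> b"
    and large: "4 * \<epsilon> \<le> L * h" and small: "\<epsilon> * h \<le> \<Delta>"
  shows "hard_instance p \<sigma> L \<Delta> \<epsilon> h b T x\<^sub>1"
proof -
  define w where "w = 2 * \<epsilon> / L"
  have w: "0 \<le> w" "L * w = 2 * \<epsilon>" "w \<le> h / 2" using assms by (auto simp: w_def field_simps)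
  define m where "m = x\<^sub>1 - h / 2"
  define F where "F x = ramp L w (x - m) + ramp L w (m - x)" for x
  define F' where "F' x = L * max (- w) (min w (x - m))" for x
  have deriv: "DERIV F x :> F' x" for x
  proof -
    have "DERIV (\<lambda>x. ramp L w (m - x)) x :> L * max 0 (min w (m - x)) * (- 1)"
      by (rule DERIV_chain2[OF DERIV_ramp]) (use w in \<open>auto intro!: derivative_eq_intros\<close>)
    then have "DERIV F x :> ramp_slope L w (x - m) + L * max 0 (min w (m - x)) * (- 1)"
      unfolding F_def[abs_def] using w by (intro DERIV_add DERIV_ramp_shift)
    also have "ramp_slope L w (x - m) + L * max 0 (min w (m - x)) * (- 1)
        = L * (max 0 (min w (x - m)) - max 0 (min w (m - x)))"
      by (simp add: ramp_slope_def right_diff_distrib)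
    also have "max 0 (min w (x - m)) - max 0 (min w (m - x)) = max (- w) (min w (x - m))"
      using w by (auto simp: max_def min_def)
    finally show ?thesis by (simp add: F'_def)
  qed
  have lip: "\<bar>F' x - F' y\<bar> \<le> L * \<bar>x - y\<bar>" for x y
  proof -
    have "\<bar>max (- w) (min w (x - m)) - max (- w) (min w (y - m))\<bar> \<le> \<bar>x - y\<bar>"
      by (auto simp: max_def min_def)
    then show ?thesis
      using assms by (simp add: F'_def right_diff_distrib[symmetric] abs_mult mult_left_mono)
  qed
  have bound: "\<bar>F' x\<bar> \<le> 2 * \<epsilon>" for x
  proof -
    have "\<bar>max (- w) (min w (x - m))\<bar> \<le> w" using w by (auto simp: max_def min_def)
    then show ?thesis unfolding w(2)[symmetric] F'_def abs_mult
      using assms by (simp add: mult_left_mono)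
  qed
  have cont: "continuous_on UNIV F'"
    unfolding F'_def by (intro continuous_intros)
  have ends: "F' x\<^sub>1 = 2 * \<epsilon>" "F' (x\<^sub>1 - h) = - (2 * \<epsilon>)"
    using w by (auto simp: F'_def m_def)
  show ?thesis
  proof (rule hard_instanceI)
    show "DERIV F x :> F' x" for x by (rule deriv)
    show "bcm_oracle p \<sigma> (return_pmf (0::real)) F (\<lambda>x _. F' x)"
      using deriv cont bound \<open>0 \<le> p\<close> by (rule bcm_oracle_deterministic)
    \<comment> \<open>At \<open>x\<^sub>1\<close> the mirrored ramp vanishes; the other one is at
      most 2\<epsilon> * \<open>h\<close> / 2.\<close>
    have "F x\<^sub>1 \<le> L * w * (h / 2)"
      using ramp_le[of L w "h / 2"] ramp_eq_0[of w "- (h / 2)" L] assms w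
      by (simp add: F_def m_def)
    then show "F x\<^sub>1 \<le> \<Delta>" using small w by simp
    fix t :: nat
    assume t: "1 \<le> t"
    interpret prob_space "iid_samples (return_pmf (0::real))"
      by (intro prob_space_iid_samples prob_space_measure_pmf)
    have abs_eq: "\<bar>F' (minibatch_nsgd (\<lambda>x _. F' x) (\<lambda>_. h) (\<lambda>_. b) x\<^sub>1 \<omega> t)\<bar> = 2 * \<epsilon>"
      for \<omega> :: "nat \<times> nat \<Rightarrow> real"
      using nsgd_oscillates[of F' x\<^sub>1 h "\<lambda>_. b" t \<omega>] ends assms t by auto
    show "\<epsilon> < (\<integral>\<omega>. \<bar>F' (minibatch_nsgd (\<lambda>x _. F' x) (\<lambda>_. h) (\<lambda>_. b) x\<^sub>1 \<omega> t)\<bar>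
        \<partial>iid_samples (return_pmf (0::real)))"
      using \<open>0 < \<epsilon>\<close> unfolding abs_eq by (simp add: prob_space)
  qed (use assms w lip in \<open>auto simp: F_def intro!: add_nonneg_nonneg ramp_nonneg\<close>)
qed

text \<open>The linear part of the ramp starts exactly at \<open>x\<^sub>1\<close>, so the initial
  gap is at most 4\<epsilon>^2 / \<open>L\<close> for every horizon; the noise drives the iterates
  uphill and keeps the expected slope at 3/4 * 2\<epsilon> or more.\<close>

lemma hard_instance_noise:
  assumes "0 < L" "0 < \<epsilon>" "0 < h" "1 < p" "p \<le> 2" "1 \<le> b"
    and small: "4 * \<epsilon>\<^sup>2 / L \<le> \<Delta>"
    and noise: "32 powr p * real b powr (p - 1) * \<epsilon> powr p \<le> \<sigma> powr p"
  shows "hard_instance p \<sigma> L \<Delta> \<epsilon> h b T x\<^sub>1"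
proof -
  define w where "w = 2 * \<epsilon> / L"
  have w: "0 \<le> w" "L * w = 2 * \<epsilon>" using assms by (auto simp: w_def)
  define a where "a = x\<^sub>1 - w"
  \<comment> \<open>The largest value allowed by the drift bound. The moment then grows like
    b^(p-1), and the factors 4 * 8 * 32^(p-1) combine to 32^p.\<close>
  define \<delta> where "\<delta> = 1 / (32 * real b)"
  have \<delta>: "0 < \<delta>" "\<delta> \<le> 1" "\<delta> * real b \<le> 1/32" using \<open>1 \<le> b\<close> by (auto simp: \<delta>_def field_simps)
  have bounds: "ramp_slope L w (x - a) \<in> {0..2 * \<epsilon>}" for x
    using ramp_slope_bounds[of L w "x - a"] assms w by simp
  then have abs_bound: "\<bar>ramp_slope L w (x - a)\<bar> \<le> 2 * \<epsilon>" for x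
    by (simp add: abs_of_nonneg)
  have "(2 * \<epsilon>) powr p * (\<integral>\<xi>. \<bar>\<xi> - 1\<bar> powr p \<partial>two_point \<delta>)
      \<le> (2 * \<epsilon>) powr p * (8 * \<delta> powr (1 - p))"
    using \<delta> assms by (intro mult_left_mono moment_two_point) auto
  also have "\<dots> = 2 powr p * (8 * (\<epsilon> powr p * \<delta> powr (1 - p)))"
    using assms by (simp add: powr_mult)
  also have "\<dots> \<le> 4 * (8 * (\<epsilon> powr p * \<delta> powr (1 - p)))"
    using powr_mono[of p 2 "2::real"] assms by (intro mult_right_mono) auto
  also have "\<delta> powr (1 - p) = (32 * real b) powr (p - 1)"
    using \<open>1 \<le> b\<close> powr_minus_divide[of "32 * real b" "1 - p"] by (simp add: \<delta>_def powr_divide)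
  also have "\<dots> = 32 powr p / 32 * real b powr (p - 1)"
    by (simp add: powr_mult powr_diff)
  also have "4 * (8 * (\<epsilon> powr p * (32 powr p / 32 * real b powr (p - 1))))
      = 32 powr p * real b powr (p - 1) * \<epsilon> powr p" by simp
  also note noise
  finally have moment: "(2 * \<epsilon>) powr p * (\<integral>\<xi>. \<bar>\<xi> - 1\<bar> powr p \<partial>two_point \<delta>) \<le> \<sigma> powr p" .
  show ?thesis
  proof (rule hard_instanceI)
    show deriv: "DERIV (\<lambda>x. ramp L w (x - a)) x :> ramp_slope L w (x - a)" for x
      using w by (intro DERIV_ramp_shift)
    show "bcm_oracle p \<sigma> (two_point \<delta>) (\<lambda>x. ramp L w (x - a)) (\<lambda>x \<xi>. ramp_slope L w (x - a) * \<xi>)"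
      using \<open>1 < p\<close>
      by (intro bcm_oracle_multiplicative[OF deriv continuous_ramp_slope abs_bound
            finite_set_two_point mean_two_point[OF \<delta>(1,2)] moment]) simp
    have "ramp L w (x\<^sub>1 - a) \<le> L * w * w"
      using ramp_le[of L w w] assms w by (simp add: a_def)
    also have "\<dots> = 4 * \<epsilon>\<^sup>2 / L"
      unfolding w(2) by (simp add: w_def power2_eq_square)
    finally show "ramp L w (x\<^sub>1 - a) \<le> \<Delta>" using small by linarith
    fix t :: nat
    assume "1 \<le> t"
    then have "3/4 * (2 * \<epsilon>) \<le> (\<integral>\<omega>. \<bar>ramp_slope L w (minibatch_nsgd (\<lambda>x \<xi>. ramp_slope L w (x - a) * \<xi>)
        (\<lambda>_. h) (\<lambda>_. b) x\<^sub>1 \<omega> t - a)\<bar> \<partial>iid_samples (two_point \<delta>))"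
      using assms \<delta> bounds w
      by (intro expectation_gradient_drift[where F' = "\<lambda>x. ramp_slope L w (x - a)"] continuous_ramp_slope)
        (auto simp: ramp_slope_eq a_def)
    then show "\<epsilon> < (\<integral>\<omega>. \<bar>ramp_slope L w (minibatch_nsgd (\<lambda>x \<xi>. ramp_slope L w (x - a) * \<xi>)
        (\<lambda>_. h) (\<lambda>_. b) x\<^sub>1 \<omega> t - a)\<bar> \<partial>iid_samples (two_point \<delta>))"
      using \<open>0 < \<epsilon>\<close> by linarith
  qed (use assms w in \<open>auto intro: ramp_nonneg ramp_slope_lipschitz\<close>)
qed

section \<open>Combining the three obstructions\<close>

lemma noise_dominates_small_batch:
  fixes b \<epsilon> \<sigma> p :: real
  assumes "1 < p" "0 < \<epsilon>" "0 \<le> \<sigma>" "0 < b"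
    and b: "b \<le> 32 powr (- (p / (p - 1))) * (\<sigma> / \<epsilon>) powr (p / (p - 1))"
  shows "32 powr p * b powr (p - 1) * \<epsilon> powr p \<le> \<sigma> powr p"
proof -
  have "b powr (p - 1) \<le> (32 powr (- (p / (p - 1))) * (\<sigma> / \<epsilon>) powr (p / (p - 1))) powr (p - 1)"
    using assms by (intro powr_mono2) auto
  also have "\<dots> = 32 powr (- p) * (\<sigma> / \<epsilon>) powr p"
    using assms by (simp add: powr_mult powr_powr)
  also have "\<dots> = \<sigma> powr p / (32 powr p * \<epsilon> powr p)"
    using assms by (simp add: powr_divide powr_minus_divide)
  finally show ?thesis using assms by (simp add: field_simps)
qed

theorem theorem2:
  fixes p q \<eta> B r :: real
  assumes "1 < p" "p \<le> 2" "0 < q" "0 < \<eta>" "0 < B" "0 < r" "r < 1"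
  shows "\<exists>c>0. \<forall>\<Delta>\<^sub>1>0. \<forall>L>0. \<forall>\<sigma>\<ge>0. \<exists>\<epsilon>\<^sub>0>0. \<forall>\<epsilon>. 0 < \<epsilon> \<and> \<epsilon> \<le> \<epsilon>\<^sub>0 \<longrightarrow>
    (\<forall>T::nat. 1 \<le> T \<and>
      real (T * batch_size B q T)
        < c * ((\<Delta>\<^sub>1 / \<epsilon>) powr ((1 + q) / (1 - r))
             + (L / \<epsilon>) powr ((1 + q) / r)
             + (\<sigma> / \<epsilon>) powr (p * (q + 1) / (q * (p - 1)))) \<longrightarrow>
      (\<forall>x\<^sub>1::real. \<exists>(F :: real \<Rightarrow> real) (D :: real measure) (G :: real \<Rightarrow> real \<Rightarrow> real).
        smooth_fun L F \<and>
        bdd_below (range F) \<and>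
        F x\<^sub>1 - (INF x. F x) \<le> \<Delta>\<^sub>1 \<and>
        bcm_oracle p \<sigma> D F G \<and>
        (\<forall>t\<in>{1..T}.
          (\<integral>\<omega>. norm (gradient F
               (minibatch_nsgd G (\<lambda>_. \<eta> * real T powr (- r)) (\<lambda>_. batch_size B q T) x\<^sub>1 \<omega> t))
             \<partial>iid_samples D) > \<epsilon>)))"
proof -
  define k where "k = 32 powr (- (p / (p - 1)))"
  define c\<^sub>1 where "c\<^sub>1 = B * (1 / (4 * \<eta>)) powr ((1 + q) / (1 - r))"
  define c\<^sub>2 where "c\<^sub>2 = B * (\<eta> / 4) powr ((1 + q) / r)"
  define c\<^sub>3 where "c\<^sub>3 = k powr (1 + 1 / q) / (2 + B) powr (1 / q)"
  \<comment> \<open>Division by 3 because each of the three terms is bounded by the sample count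
    separately, and the three bounds are added.\<close>
  define c where "c = min c\<^sub>1 (min c\<^sub>2 c\<^sub>3) / 3"
  have "0 < c" using assms by (auto simp: c_def c\<^sub>1_def c\<^sub>2_def c\<^sub>3_def k_def)
  have main: "\<exists>\<epsilon>\<^sub>0>0. \<forall>\<epsilon>. 0 < \<epsilon> \<and> \<epsilon> \<le> \<epsilon>\<^sub>0 \<longrightarrow> (\<forall>T::nat. 1 \<le> T \<and>
      real (T * batch_size B q T)
        < c * ((\<Delta>\<^sub>1 / \<epsilon>) powr ((1 + q) / (1 - r))
             + (L / \<epsilon>) powr ((1 + q) / r)
             + (\<sigma> / \<epsilon>) powr (p * (q + 1) / (q * (p - 1)))) \<longrightarrow>
      (\<forall>x\<^sub>1. hard_instance p \<sigma> L \<Delta>\<^sub>1 \<epsilon> (\<eta> * real T powr (- r)) (batch_size B q T) T x\<^sub>1))"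
    if pos: "0 < \<Delta>\<^sub>1" "0 < L" "0 \<le> \<sigma>" for \<Delta>\<^sub>1 L \<sigma>
  \<comment> \<open>The first threshold gives 4\<epsilon>^2 / \<open>L\<close> \<le>
    \<open>\<Delta>\<^sub>1 / 2\<close>, the height of the curved parts; the second gives \<epsilon>
    * h \<le> \<open>\<Delta>\<^sub>1\<close> because the step length is at most \<eta>.\<close>
  proof (intro exI[of _ "min (sqrt (\<Delta>\<^sub>1 * L / 8)) (\<Delta>\<^sub>1 / \<eta>)"] conjI allI impI; (elim conjE)?)
    show "0 < min (sqrt (\<Delta>\<^sub>1 * L / 8)) (\<Delta>\<^sub>1 / \<eta>)" using assms pos by simp
    fix \<epsilon> :: real and T :: nat and x\<^sub>1 :: real
    assume "0 < \<epsilon>" and \<epsilon>: "\<epsilon> \<le> min (sqrt (\<Delta>\<^sub>1 * L / 8)) (\<Delta>\<^sub>1 / \<eta>)" and "1 \<le> T"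
      and samples: "real (T * batch_size B q T)
        < c * ((\<Delta>\<^sub>1 / \<epsilon>) powr ((1 + q) / (1 - r)) + (L / \<epsilon>) powr ((1 + q) / r)
             + (\<sigma> / \<epsilon>) powr (p * (q + 1) / (q * (p - 1))))"
    define h where "h = \<eta> * real T powr (- r)"
    have "0 < h" using assms \<open>1 \<le> T\<close> by (simp add: h_def)
    have "\<epsilon>\<^sup>2 \<le> (sqrt (\<Delta>\<^sub>1 * L / 8))\<^sup>2" using \<epsilon> \<open>0 < \<epsilon>\<close> by (intro power_mono) auto
    then have \<epsilon>_sq: "4 * \<epsilon>\<^sup>2 / L \<le> \<Delta>\<^sub>1 / 2" using pos by (simp add: field_simps)
    have "real T powr (- r) \<le> 1"
      using powr_mono[of "- r" 0 "real T"] assms \<open>1 \<le> T\<close> by simp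
    then have "h \<le> \<eta> * 1" unfolding h_def using assms by (intro mult_left_mono) auto
    then have "\<epsilon> * h \<le> \<Delta>\<^sub>1 / \<eta> * \<eta>"
      using \<epsilon> \<open>0 < \<epsilon>\<close> \<open>0 < h\<close> pos assms by (intro mult_mono) auto
    then have \<epsilon>h: "\<epsilon> * h \<le> \<Delta>\<^sub>1" using assms by simp
    show "hard_instance p \<sigma> L \<Delta>\<^sub>1 \<epsilon> (\<eta> * real T powr (- r)) (batch_size B q T) T x\<^sub>1"
      unfolding h_def[symmetric]
    \<comment> \<open>If no instance is hard, each obstruction fails, and each failure bounds the
      sample count below by one term of the sum.\<close>
    proof (rule ccontr)
      assume none: "\<not> hard_instance p \<sigma> L \<Delta>\<^sub>1 \<epsilon> h (batch_size B q T) T x\<^sub>1"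
      note b = batch_size_ge_1[of B q T]
      have "\<not> 2 * \<epsilon> * (h * real T) \<le> \<Delta>\<^sub>1 / 2"
        using hard_instance_short_path[of L \<epsilon> h p \<Delta>\<^sub>1 T \<sigma>] none \<epsilon>_sq pos assms \<open>0 < \<epsilon>\<close> \<open>0 < h\<close> by auto
      moreover have "h * real T = \<eta> * real T powr (1 - r)"
        using \<open>1 \<le> T\<close> by (simp add: h_def powr_diff powr_minus_divide)
      ultimately have "1 / (4 * \<eta>) * (\<Delta>\<^sub>1 / \<epsilon>) \<le> real T powr (1 - r)"
        using assms \<open>0 < \<epsilon>\<close> by (simp add: field_simps)
      then have 1: "c\<^sub>1 * (\<Delta>\<^sub>1 / \<epsilon>) powr ((1 + q) / (1 - r)) \<le> real (T * batch_size B q T)"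
        unfolding c\<^sub>1_def using assms pos \<open>0 < \<epsilon>\<close> \<open>1 \<le> T\<close> by (intro samples_ge_of_horizon) auto
      have "\<not> 4 * \<epsilon> \<le> L * h"
        using hard_instance_oscillation[of L \<epsilon> p "batch_size B q T" h \<Delta>\<^sub>1] none \<epsilon>h b pos assms \<open>0 < \<epsilon>\<close>
        by auto
      then have "\<eta> / 4 * (L / \<epsilon>) \<le> real T powr r"
        using assms \<open>0 < \<epsilon>\<close> \<open>1 \<le> T\<close> by (simp add: h_def powr_minus_divide field_simps)
      then have 2: "c\<^sub>2 * (L / \<epsilon>) powr ((1 + q) / r) \<le> real (T * batch_size B q T)"
        unfolding c\<^sub>2_def using assms pos \<open>0 < \<epsilon>\<close> \<open>1 \<le> T\<close> by (intro samples_ge_of_horizon) auto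
      have "\<not> 32 powr p * real (batch_size B q T) powr (p - 1) * \<epsilon> powr p \<le> \<sigma> powr p"
        using hard_instance_noise[of L \<epsilon> h p "batch_size B q T" \<Delta>\<^sub>1 \<sigma>] none \<epsilon>_sq b pos assms \<open>0 < \<epsilon>\<close> \<open>0 < h\<close>
        by auto
      then have "k * (\<sigma> / \<epsilon>) powr (p / (p - 1)) \<le> batch_size B q T"
        using noise_dominates_small_batch[of p \<epsilon> \<sigma> "batch_size B q T"] b pos assms \<open>0 < \<epsilon>\<close>
        unfolding k_def by linarith
      then have "c\<^sub>3 * ((\<sigma> / \<epsilon>) powr (p / (p - 1))) powr (1 + 1 / q) \<le> real (T * batch_size B q T)"
        unfolding c\<^sub>3_def using assms \<open>1 \<le> T\<close> by (intro samples_ge_of_batch) (auto simp: k_def)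
      \<comment> \<open>The batch size scales with exponent p/(p-1), and passing from batch size to
        sample count multiplies exponents by 1 + 1/q.\<close>
      moreover have "p / (p - 1) * (1 + 1 / q) = p * (q + 1) / (q * (p - 1))"
        using assms by (simp add: field_simps)
      ultimately have 3: "c\<^sub>3 * (\<sigma> / \<epsilon>) powr (p * (q + 1) / (q * (p - 1))) \<le> real (T * batch_size B q T)"
        by (simp only: powr_powr)
      have c_le: "3 * c * (y powr z) \<le> c' * (y powr z)" if "c' \<in> {c\<^sub>1, c\<^sub>2, c\<^sub>3}" for c' y z
        using that by (intro mult_right_mono) (auto simp: c_def)
      show False
        using samples 1 2 3 c_le[of c\<^sub>1 "\<Delta>\<^sub>1 / \<epsilon>" "(1 + q) / (1 - r)"] c_le[of c\<^sub>2 "L / \<epsilon>" "(1 + q) / r"]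
          c_le[of c\<^sub>3 "\<sigma> / \<epsilon>" "p * (q + 1) / (q * (p - 1))"]
        by (simp add: distrib_left)
    qed
  qed
  show ?thesis
    unfolding hard_instance_def[symmetric]
    by (rule exI[of _ c], rule conjI[OF \<open>0 < c\<close>], intro allI impI, rule main)
qed

end
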